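(* There exists $M\in\mathcal{LC}$ having $(\mathrm{mg})$ and $(\beta_1)$ (i.e. $M$ is equivalent to some $N\in\mathcal{SR}$) such that there does not exist a sequence of positive integers $(a_j)_{j\ge1}$ which is a sequence of Lusky numbers for $M$.
   Context: $\mathbb{N}=\{0,1,2,\dots\}$. For a sequence $M=(M_p)_{p\in\mathbb{N}}$ of positive reals put $\mu_p:=M_p/M_{p-1}$ for $p\ge1$ and $\mu_0:=1$. $M$ is normalized if $M_0=1\le M_1$, and log-convex if $M_p^2\le M_{p-1}M_{p+1}$ for all $p\ge1$. $\mathcal{LC}$ is the set of all normalized log-convex $M$ with $\lim_{p\to\infty}(M_p)^{1/p}=+\infty$. $M$ has $(\mathrm{mg})$ if there is $C\ge1$ with $M_{j+k}\le C^{j+k}M_jM_k$ for all $j,k\in\mathbb{N}$. $M$ has $(\beta_1)$ if there is an integer $Q\ge2$ with $\liminf_{p\to\infty}\mu_{Qp}/\mu_p>Q$. $M$ has $(\gamma_1)$ if $\sup_{j\ge1}\frac{\mu_j}{j}\sum_{k\ge j}\frac{1}{\mu_k}<+\infty$. $M$ has $(\mathrm{slc})$ if $(M_p/p!)_p$ is log-convex. $\mathcal{SR}$ is the set of normalized $M$ having $(\mathrm{slc})$, $(\mathrm{mg})$ and $(\gamma_1)$. $M$ and $N$ are equivalent if $\sup_{p\ge1}(M_p/N_p)^{1/p}<+\infty$ and $\sup_{p\ge1}(N_p/M_p)^{1/p}<+\infty$. For integers $0\le k<l$, $$A_M(k,l):=\frac{(\mu_{l+1})^{l-k}}{\mu_{k+1}\cdots\mu_l},\qquad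 B_M(k,l):=\frac{\mu_{k+1}\cdots\mu_l}{(\mu_{k+1})^{l-k}}.$$ A strictly increasing sequence of nonnegative integers $(a_j)_{j\ge1}$ is called a sequence of Lusky numbers for $M$ if there exist constants $K\ge b>2$ such that for all $j\ge1$: $b\le\min\{A_M(a_j,a_{j+1}),B_M(a_j,a_{j+1})\}\le\max\{A_M(a_j,a_{j+1}),B_M(a_j,a_{j+1})\}\le K$. *)

theory Defs
  imports Complex_Main "HOL-Library.Extended_Real" "HOL-Library.Extended_Nonnegative_Real"
begin

definition pos_seq :: "(nat \<Rightarrow> real) \<Rightarrow> bool" where
  "pos_seq M \<longleftrightarrow> (\<forall>p. 0 < M p)"

definition quotient_seq :: "(nat \<Rightarrow> real) \<Rightarrow> nat \<Rightarrow> real" where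
  "quotient_seq M p = (if p = 0 then 1 else M p / M (p - 1))"

definition normalized_seq :: "(nat \<Rightarrow> real) \<Rightarrow> bool" where
  "normalized_seq M \<longleftrightarrow> M 0 = 1 \<and> 1 \<le> M 1"

definition log_convex :: "(nat \<Rightarrow> real) \<Rightarrow> bool" where
  "log_convex M \<longleftrightarrow> (\<forall>p\<ge>1. (M p)\<^sup>2 \<le> M (p - 1) * M (p + 1))"

definition LC :: "(nat \<Rightarrow> real) set" where
  "LC = {M. pos_seq M \<and> normalized_seq M \<and> log_convex M \<and>
            filterlim (\<lambda>p. M p powr (1 / real p)) at_top sequentially}"

definition mod_growth :: "(nat \<Rightarrow> real) \<Rightarrow> bool" where
  "mod_growth M \<longleftrightarrow> (\<exists>C\<ge>1. \<forall>j k. M (j + k) \<le> C ^ (j + k) * M j * M k)"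

text \<open>The lower limit is taken in the extended reals, as it may be infinite.\<close>

definition beta1 :: "(nat \<Rightarrow> real) \<Rightarrow> bool" where
  "beta1 M \<longleftrightarrow> (\<exists>Q\<ge>2. liminf (\<lambda>p. ereal (quotient_seq M (Q * p) / quotient_seq M p)) > ereal (real Q))"

text \<open>The tail sum over \<open>k \<ge> j\<close> is indexed as \<open>j + k\<close> with \<open>k \<ge> 0\<close> and taken in
  \<open>[0, \<infinity>]\<close>, so that finiteness of the supremum includes convergence of the series.\<close>

definition gamma1 :: "(nat \<Rightarrow> real) \<Rightarrow> bool" where
  "gamma1 M \<longleftrightarrow>
     (SUP j\<in>{1..}. ennreal (quotient_seq M j / real j) * (\<Sum>k. ennreal (1 / quotient_seq M (j + k)))) < \<infinity>"

definition strongly_log_convex :: "(nat \<Rightarrow> real) \<Rightarrow> bool" where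
  "strongly_log_convex M \<longleftrightarrow> log_convex (\<lambda>p. M p / fact p)"

definition SR :: "(nat \<Rightarrow> real) set" where
  "SR = {M. pos_seq M \<and> normalized_seq M \<and> strongly_log_convex M \<and> mod_growth M \<and> gamma1 M}"

definition equivalent_seq :: "(nat \<Rightarrow> real) \<Rightarrow> (nat \<Rightarrow> real) \<Rightarrow> bool" where
  "equivalent_seq M N \<longleftrightarrow>
     bdd_above ((\<lambda>p. (M p / N p) powr (1 / real p)) ` {1..}) \<and>
     bdd_above ((\<lambda>p. (N p / M p) powr (1 / real p)) ` {1..})"

text \<open>The next two expressions are only meaningful, and only used, for \<open>k < l\<close>.\<close>

definition lusky_A :: "(nat \<Rightarrow> real) \<Rightarrow> nat \<Rightarrow> nat \<Rightarrow> real" where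
  "lusky_A M k l = quotient_seq M (l + 1) ^ (l - k) / (\<Prod>i=k+1..l. quotient_seq M i)"

definition lusky_B :: "(nat \<Rightarrow> real) \<Rightarrow> nat \<Rightarrow> nat \<Rightarrow> real" where
  "lusky_B M k l = (\<Prod>i=k+1..l. quotient_seq M i) / quotient_seq M (k + 1) ^ (l - k)"

text \<open>Sequences of Lusky numbers are indexed from \<open>1\<close>; the value \<open>a 0\<close> plays no role.\<close>

definition lusky_numbers :: "(nat \<Rightarrow> real) \<Rightarrow> (nat \<Rightarrow> nat) \<Rightarrow> bool" where
  "lusky_numbers M a \<longleftrightarrow>
     strict_mono_on {1..} a \<and>
     (\<exists>b K :: real. 2 < b \<and> b \<le> K \<and>
        (\<forall>j\<ge>1. b \<le> min (lusky_A M (a j) (a (j + 1))) (lusky_B M (a j) (a (j + 1))) \<and>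
               max (lusky_A M (a j) (a (j + 1))) (lusky_B M (a j) (a (j + 1))) \<le> K))"

end

theory Submission
  imports Defs "HOL-Library.Discrete_Functions"
begin

text \<open>
  Lusky numbers \<open>a\<^sub>j\<close> cut the indices into blocks on which the quotients \<open>\<mu>\<close> grow neither too
  little nor too much.  They cannot exist when \<open>\<mu>\<close> is a step function whose jumps are large and lie
  farther and farther apart.  The example is \<open>\<mu>\<^sub>p = 4\<^sup>n\<close> for \<open>2\<^sup>n \<le> p < 2\<^sup>n\<^sup>+\<^sup>1\<close>.

  Let \<open>k < l\<close> be consecutive Lusky numbers.  As \<open>B(k,l) > 1\<close>, some jump \<open>2\<^sup>n\<close> lies in
  \<open>{k+2..l}\<close>.  Every index of the block from the jump on contributes a factor of at least \<open>4\<close> to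
  \<open>B(k,l)\<close>, and every index of the block before the jump contributes one to \<open>A(k,l)\<close>
  (\<open>lusky_B_ge_power\<close>, \<open>lusky_A_ge_power\<close>).  So the upper bound \<open>K\<close> keeps both \<open>k\<close> and \<open>l\<close> within a
  distance \<open>T\<close> of the jump that depends on \<open>K\<close> only.  The next block starts at \<open>l\<close>, and hence its
  jump is within \<open>T\<close> of \<open>l\<close> and within \<open>2T\<close> of the previous jump \<open>2\<^sup>n\<close>.  But the next jump after \<open>2\<^sup>n\<close> is
  \<open>2\<^sup>n\<^sup>+\<^sup>1\<close>, at distance \<open>2\<^sup>n\<close>, which is a contradiction when \<open>j\<close>, and thus \<open>n\<close>, is large.

  The regularity of \<open>M\<close> comes from a comparison with \<open>(p!)\<^sup>2\<close>, whose quotients are \<open>p\<^sup>2\<close>: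
  since \<open>4\<^sup>n \<le> p\<^sup>2 \<le> 4 \<cdot> 4\<^sup>n\<close> in the \<open>n\<close>-th dyadic block, \<open>M\<^sub>p \<le> (p!)\<^sup>2 \<le> 4\<^sup>p M\<^sub>p\<close>.  Moderate growth and
  the divergence of the roots therefore pass from \<open>(p!)\<^sup>2\<close> to \<open>M\<close>, and \<open>((p!)\<^sup>2)\<^sub>p\<close> is the equivalent
  strongly regular sequence.
\<close>

section \<open>Sequences with increasing quotients\<close>

text \<open>Each of the last \<open>l + 1 - s\<close> factors of \<open>B(k,l) = \<Prod>\<^sub>i \<mu>\<^sub>i / \<mu>\<^sub>k\<^sub>+\<^sub>1\<close> is at least \<open>\<mu>\<^sub>s / \<mu>\<^sub>k\<^sub>+\<^sub>1 \<ge> c\<close>,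
  and by monotonicity the others are at least \<open>1\<close>.\<close>

lemma lusky_B_ge_power:
  fixes c :: real
  assumes pos: "\<And>i. 0 < quotient_seq M i"
    and mono: "\<And>i j. 0 < i \<Longrightarrow> i \<le> j \<Longrightarrow> quotient_seq M i \<le> quotient_seq M j"
    and s: "k < s" and c: "0 \<le> c" "c * quotient_seq M (k + 1) \<le> quotient_seq M s"
  shows "c ^ (l + 1 - s) \<le> lusky_B M k l"
proof -
  let ?f = "\<lambda>i. quotient_seq M i / quotient_seq M (k + 1)"
  have "c ^ (l + 1 - s) = (\<Prod>i=s..l. c)" by simp
  also have "\<dots> \<le> prod ?f {s..l}"
  proof (rule prod_mono)
    fix i assume "i \<in> {s..l}"
    then have "quotient_seq M s \<le> quotient_seq M i" using s by (intro mono) auto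
    then show "0 \<le> c \<and> c \<le> ?f i" using c pos[of "k+1"] by (simp add: field_simps)
  qed
  also have "\<dots> \<le> prod ?f {k+1..l}"
  proof (rule prod_mono2)
    fix i assume "i \<in> {k+1..l} - {s..l}"
    then show "1 \<le> ?f i" using mono[of "k+1" i] pos[of "k+1"] by simp
  qed (use s in \<open>auto simp: pos less_imp_le\<close>)
  also have "\<dots> = lusky_B M k l" by (simp add: lusky_B_def prod_dividef)
  finally show ?thesis .
qed

text \<open>The mirror image: each of the first \<open>s - (k + 1)\<close> factors of
  \<open>A(k,l) = \<Prod>\<^sub>i \<mu>\<^sub>l\<^sub>+\<^sub>1 / \<mu>\<^sub>i\<close> is at least \<open>\<mu>\<^sub>l\<^sub>+\<^sub>1 / \<mu>\<^sub>s\<^sub>-\<^sub>1 \<ge> c\<close>.\<close>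

lemma lusky_A_ge_power:
  fixes c :: real
  assumes pos: "\<And>i. 0 < quotient_seq M i"
    and mono: "\<And>i j. 0 < i \<Longrightarrow> i \<le> j \<Longrightarrow> quotient_seq M i \<le> quotient_seq M j"
    and s: "s \<le> l + 1" and c: "0 \<le> c" "c * quotient_seq M (s - 1) \<le> quotient_seq M (l + 1)"
  shows "c ^ (s - (k + 1)) \<le> lusky_A M k l"
proof -
  let ?f = "\<lambda>i. quotient_seq M (l + 1) / quotient_seq M i"
  have "c ^ (s - (k + 1)) = (\<Prod>i=k+1..<s. c)" by simp
  also have "\<dots> \<le> prod ?f {k+1..<s}"
  proof (rule prod_mono)
    fix i assume "i \<in> {k+1..<s}"
    then have "quotient_seq M i \<le> quotient_seq M (s - 1)" by (intro mono) auto
    then have "c * quotient_seq M i \<le> quotient_seq M (l + 1)"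
      using c by (meson mult_left_mono order_trans)
    then show "0 \<le> c \<and> c \<le> ?f i" using c pos[of i] by (simp add: field_simps)
  qed
  also have "\<dots> \<le> prod ?f {k+1..l}"
  proof (rule prod_mono2)
    fix i assume "i \<in> {k+1..l} - {k+1..<s}"
    then show "1 \<le> ?f i" using mono[of i "l+1"] pos[of i] by simp
  qed (use s in \<open>auto simp: pos less_imp_le\<close>)
  also have "\<dots> = lusky_A M k l" by (simp add: lusky_A_def prod_dividef)
  finally show ?thesis .
qed

text \<open>\<open>M\<^sub>p\<^sup>2 \<le> M\<^sub>p\<^sub>-\<^sub>1 M\<^sub>p\<^sub>+\<^sub>1\<close> is the inequality \<open>\<mu>\<^sub>p \<le> \<mu>\<^sub>p\<^sub>+\<^sub>1\<close> with its denominators cleared.\<close>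

lemma log_convexI:
  assumes pos: "pos_seq M"
    and mono: "\<And>p. 1 \<le> p \<Longrightarrow> quotient_seq M p \<le> quotient_seq M (p + 1)"
  shows "log_convex M"
  unfolding log_convex_def
proof (intro allI impI)
  fix p :: nat assume p: "1 \<le> p"
  have "0 < M p" "0 < M (p - 1)" using pos by (auto simp: pos_seq_def)
  then show "(M p)\<^sup>2 \<le> M (p - 1) * M (p + 1)"
    using mono[OF p] p by (simp add: quotient_seq_def field_simps power2_eq_square)
qed

section \<open>The squared factorials\<close>

lemma quotient_fact_sq: "1 \<le> p \<Longrightarrow> quotient_seq (\<lambda>p. (fact p)\<^sup>2) p = (real p)\<^sup>2"
  by (cases p) (simp_all add: quotient_seq_def field_simps power2_eq_square)

lemma fact_add_le: "(fact (j + k) :: real) \<le> 2 ^ (j + k) * (fact j * fact k)"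
proof -
  have "(fact (j + k) :: real) = real ((j + k) choose j) * (fact j * fact k)"
    by (simp add: binomial_fact)
  also have "\<dots> \<le> 2 ^ (j + k) * (fact j * fact k)"
    using binomial_le_pow2[of "j + k" j] by (intro mult_right_mono) (simp_all flip: of_nat_le_iff)
  finally show ?thesis .
qed

lemma fact_sq_add_le: "(fact (j + k))\<^sup>2 \<le> 4 ^ (j + k) * (fact j)\<^sup>2 * (fact k :: real)\<^sup>2"
proof -
  have four: "(4 :: real) ^ (j + k) = (2 ^ (j + k))\<^sup>2"
    by (simp add: power2_eq_square flip: power_mult_distrib)
  have "(fact (j + k))\<^sup>2 \<le> (2 ^ (j + k) * (fact j * fact k) :: real)\<^sup>2"
    using fact_add_le by (intro power_mono) auto
  also have "\<dots> = 4 ^ (j + k) * (fact j)\<^sup>2 * (fact k)\<^sup>2"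
    unfolding four power_mult_distrib by (simp add: mult.assoc)
  finally show ?thesis .
qed

text \<open>Comparison with a telescoping series: \<open>1/n\<^sup>2 \<le> 2 (1/n - 1/(n+1))\<close> since \<open>n + 1 \<le> 2n\<close>.\<close>

lemma suminf_inverse_squares_tail_le:
  assumes "1 \<le> j"
  shows "(\<Sum>k. ennreal (1 / (real (j + k))\<^sup>2)) \<le> ennreal (2 / real j)"
proof -
  let ?g = "\<lambda>k. 2 / real (j + k)"
  have "(\<lambda>k. 2 / real (k + j)) \<longlonglongrightarrow> 0"
    by (rule LIMSEQ_ignore_initial_segment[OF lim_const_over_n])
  then have "?g \<longlonglongrightarrow> 0" by (simp add: add.commute)
  from telescope_sums'[OF this]
  have sums: "(\<lambda>k. ?g k - ?g (Suc k)) sums (2 / real j)" by simp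
  have "(\<Sum>k. ennreal (1 / (real (j + k))\<^sup>2)) \<le> (\<Sum>k. ennreal (?g k - ?g (Suc k)))"
  proof (intro suminf_le ennreal_leI)
    fix k
    define n where "n = real (j + k)"
    have n: "1 \<le> n" using assms by (simp add: n_def)
    have "1 / n\<^sup>2 \<le> 2 / n - 2 / (n + 1)"
    proof -
      have "1 / n\<^sup>2 = 2 / (n * (2 * n))" by (simp add: power2_eq_square)
      also have "\<dots> \<le> 2 / (n * (n + 1))"
        using n by (intro divide_left_mono mult_left_mono) auto
      also have "\<dots> = 2 / n - 2 / (n + 1)" using n by (simp add: divide_simps)
      finally show ?thesis .
    qed
    then show "1 / (real (j + k))\<^sup>2 \<le> ?g k - ?g (Suc k)"
      by (simp add: n_def add.commute add.left_commute)
  qed auto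
  also have "\<dots> = ennreal (2 / real j)"
    using assms by (intro suminf_ennreal_eq[OF _ sums]) (simp add: frac_le)
  finally show ?thesis .
qed

lemma gamma1_fact_sq: "gamma1 (\<lambda>p. (fact p)\<^sup>2)"
proof -
  let ?q = "quotient_seq (\<lambda>p. (fact p)\<^sup>2)"
  have "(SUP j\<in>{1..}. ennreal (?q j / real j) * (\<Sum>k. ennreal (1 / ?q (j + k)))) \<le> 2"
  proof (rule SUP_least)
    fix j :: nat assume "j \<in> {1..}"
    then have j: "1 \<le> j" by simp
    have "ennreal (?q j / real j) * (\<Sum>k. ennreal (1 / ?q (j + k)))
        = ennreal (real j) * (\<Sum>k. ennreal (1 / (real (j + k))\<^sup>2))"
      using j by (simp only: quotient_fact_sq trans_le_add1)
        (simp add: power2_eq_square[of "real j"])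
    also have "\<dots> \<le> ennreal (real j) * ennreal (2 / real j)"
      using suminf_inverse_squares_tail_le[OF j] by (rule mult_left_mono) simp
    also have "\<dots> = 2" using j by (simp flip: ennreal_mult)
    finally show "ennreal (?q j / real j) * (\<Sum>k. ennreal (1 / ?q (j + k))) \<le> 2" .
  qed
  also have "\<dots> < \<infinity>" by simp
  finally show ?thesis unfolding gamma1_def .
qed

lemma fact_sq_in_SR: "(\<lambda>p. (fact p)\<^sup>2) \<in> SR"
proof -
  have "log_convex fact"
    by (rule log_convexI)
       (auto simp: pos_seq_def quotient_seq_def field_simps fact_reduce)
  then have "strongly_log_convex (\<lambda>p. (fact p)\<^sup>2)"
    by (simp add: strongly_log_convex_def power2_eq_square)
  moreover have "mod_growth (\<lambda>p. (fact p)\<^sup>2)"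
    unfolding mod_growth_def using fact_sq_add_le by (intro exI[of _ 4]) auto
  ultimately show ?thesis
    using gamma1_fact_sq by (simp add: SR_def pos_seq_def normalized_seq_def)
qed

section \<open>The dyadic step sequence\<close>

definition dyadic_step :: "nat \<Rightarrow> real" where
  "dyadic_step p = (\<Prod>i=1..p. 4 ^ floor_log i)"

lemma dyadic_step_pos: "0 < dyadic_step p"
  unfolding dyadic_step_def by (intro prod_pos) simp

lemma quotient_dyadic_step: "quotient_seq dyadic_step p = 4 ^ floor_log p"
  using dyadic_step_pos[of "p - 1"]
  by (cases p) (simp_all add: quotient_seq_def dyadic_step_def)

lemma quotient_dyadic_step_mono:
  "i \<le> j \<Longrightarrow> quotient_seq dyadic_step i \<le> quotient_seq dyadic_step j"
  by (simp add: quotient_dyadic_step floor_log_le_iff)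

lemma four_power_floor_log_bounds:
  assumes "0 < i"
  shows "4 ^ floor_log i \<le> (real i)\<^sup>2" "(real i)\<^sup>2 \<le> 4 * 4 ^ floor_log i"
proof -
  have sq: "(4 :: real) ^ floor_log i = (2 ^ floor_log i)\<^sup>2"
    by (simp add: power2_eq_square flip: power_mult_distrib)
  have "(2 :: real) ^ floor_log i \<le> real i"
    using floor_log_exp2_le[OF assms] by (simp flip: of_nat_le_iff)
  then show "4 ^ floor_log i \<le> (real i)\<^sup>2" unfolding sq by (intro power_mono) auto
  have "real i \<le> 2 * 2 ^ floor_log i"
    using floor_log_exp2_ge[of i] of_nat_le_iff[of i "2 * 2 ^ floor_log i", where ?'a = real]
    by simp
  then have "(real i)\<^sup>2 \<le> (2 * 2 ^ floor_log i)\<^sup>2" by (intro power_mono) auto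
  then show "(real i)\<^sup>2 \<le> 4 * 4 ^ floor_log i" by (simp add: sq power_mult_distrib)
qed

lemma fact_sq_eq_prod: "(fact p :: real)\<^sup>2 = (\<Prod>i=1..p. (real i)\<^sup>2)"
  by (simp add: fact_prod prod_power_distrib)

lemma dyadic_step_le_fact_sq: "dyadic_step p \<le> (fact p)\<^sup>2"
  unfolding dyadic_step_def fact_sq_eq_prod
  by (intro prod_mono) (simp add: four_power_floor_log_bounds)

lemma fact_sq_le_dyadic_step: "(fact p)\<^sup>2 \<le> 4 ^ p * dyadic_step p"
proof -
  have "(fact p)\<^sup>2 \<le> (\<Prod>i=1..p. 4 * (4 :: real) ^ floor_log i)"
    unfolding fact_sq_eq_prod by (intro prod_mono) (simp add: four_power_floor_log_bounds)
  also have "\<dots> = 4 ^ p * dyadic_step p" by (simp add: dyadic_step_def prod.distrib)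
  finally show ?thesis .
qed

lemma mod_growth_dyadic_step: "mod_growth dyadic_step"
  unfolding mod_growth_def
proof (intro exI[of _ 16] conjI allI)
  fix j k
  have "dyadic_step (j + k) \<le> (fact (j + k))\<^sup>2" by (rule dyadic_step_le_fact_sq)
  also have "\<dots> \<le> 4 ^ (j + k) * ((fact j)\<^sup>2 * (fact k)\<^sup>2)"
    using fact_sq_add_le[of j k] by (simp add: mult.assoc)
  also have "\<dots> \<le> 4 ^ (j + k) * ((4 ^ j * dyadic_step j) * (4 ^ k * dyadic_step k))"
    using fact_sq_le_dyadic_step
    by (intro mult_left_mono mult_mono) (auto simp: dyadic_step_pos less_imp_le)
  also have "\<dots> = (4 * 4) ^ (j + k) * dyadic_step j * dyadic_step k"
    unfolding power_mult_distrib by (simp add: power_add)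
  finally show "dyadic_step (j + k) \<le> 16 ^ (j + k) * dyadic_step j * dyadic_step k" by simp
qed simp

text \<open>The quotient sequence is multiplied by \<open>4\<close> when \<open>p\<close> is doubled, so \<open>Q = 2\<close> works.\<close>

lemma beta1_dyadic_step: "beta1 dyadic_step"
  unfolding beta1_def
proof (intro exI[of _ 2] conjI)
  let ?r = "\<lambda>p. ereal (quotient_seq dyadic_step (2 * p) / quotient_seq dyadic_step p)"
  have "\<forall>\<^sub>F p in sequentially. 4 \<le> ?r p"
    using eventually_gt_at_top[of 0] by eventually_elim (simp add: quotient_dyadic_step)
  then have "4 \<le> liminf ?r" by (rule Liminf_bounded)
  moreover have "ereal (real 2) < 4" by simp
  ultimately show "ereal (real 2) < liminf ?r" by (rule less_le_trans[rotated])
qed simp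

text \<open>The roots of \<open>M\<^sub>p \<ge> (p!)\<^sup>2 / 4\<^sup>p \<ge> p! / 4\<^sup>p\<close> diverge because \<open>p!\<close> eventually exceeds \<open>(4z)\<^sup>p\<close>
  for every \<open>z\<close>.\<close>

lemma dyadic_step_root_at_top:
  "filterlim (\<lambda>p. dyadic_step p powr (1 / real p)) at_top sequentially"
proof (rule filterlim_at_top_gt[THEN iffD2, rule_format, of 0])
  fix z :: real assume z: "0 < z"
  have "(\<lambda>p. inverse (fact p) * (4 * z) ^ p) \<longlonglongrightarrow> 0"
    by (rule summable_LIMSEQ_zero[OF summable_exp])
  then have "\<forall>\<^sub>F p in sequentially. inverse (fact p) * (4 * z) ^ p < 1"
    by (rule order_tendstoD) simp
  then show "\<forall>\<^sub>F p in sequentially. z \<le> dyadic_step p powr (1 / real p)"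
    using eventually_gt_at_top[of 0]
  proof eventually_elim
    case (elim p)
    have "4 ^ p * z ^ p \<le> fact p"
      using elim by (simp add: field_simps power_mult_distrib)
    also have "\<dots> \<le> (fact p :: real)\<^sup>2" by (simp add: power2_eq_square fact_ge_1)
    also have "\<dots> \<le> 4 ^ p * dyadic_step p" by (rule fact_sq_le_dyadic_step)
    finally have "z ^ p \<le> dyadic_step p" by simp
    then have "(z ^ p) powr (1 / real p) \<le> dyadic_step p powr (1 / real p)"
      using z by (intro powr_mono2) auto
    then show ?case using z elim by (simp add: powr_powr flip: powr_realpow)
  qed
qed

lemma dyadic_step_in_LC: "dyadic_step \<in> LC"
proof -
  have "pos_seq dyadic_step" by (simp add: pos_seq_def dyadic_step_pos)
  moreover from this have "log_convex dyadic_step"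
    by (rule log_convexI) (simp add: quotient_dyadic_step_mono)
  ultimately show ?thesis
    using dyadic_step_root_at_top by (simp add: LC_def normalized_seq_def) (simp add: dyadic_step_def)
qed

lemma dyadic_step_equivalent_fact_sq: "equivalent_seq dyadic_step (\<lambda>p. (fact p)\<^sup>2)"
  unfolding equivalent_seq_def
proof (intro conjI bdd_aboveI2)
  fix p :: nat assume "p \<in> {1..}"
  then have p: "1 \<le> p" by simp
  have "(dyadic_step p / (fact p)\<^sup>2) powr (1 / real p) \<le> 1 powr (1 / real p)"
    using dyadic_step_le_fact_sq[of p] dyadic_step_pos[of p] by (intro powr_mono2) auto
  then show "(dyadic_step p / (fact p)\<^sup>2) powr (1 / real p) \<le> 1" by simp
  have "((fact p)\<^sup>2 / dyadic_step p) powr (1 / real p) \<le> (4 ^ p) powr (1 / real p)"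
    using fact_sq_le_dyadic_step[of p] dyadic_step_pos[of p]
    by (intro powr_mono2) (auto simp: field_simps)
  also have "\<dots> = 4" using p by (simp add: powr_powr flip: powr_realpow)
  finally show "((fact p)\<^sup>2 / dyadic_step p) powr (1 / real p) \<le> 4" .
qed

section \<open>Non-existence of Lusky numbers\<close>

text \<open>The block has a jump, since \<open>B(k,l) = 1\<close> otherwise; the relevant one is the last,
  \<open>2 ^ floor_log l\<close>.  A distance of more than \<open>T\<close> from it to either end makes \<open>A(k,l)\<close> or \<open>B(k,l)\<close> at least
  \<open>4\<^sup>T\<close>.\<close>

lemma lusky_block_near_jump:
  assumes "k < l" and B: "1 < lusky_B dyadic_step k l"
    and K: "lusky_A dyadic_step k l \<le> K" "lusky_B dyadic_step k l \<le> K" "K < 4 ^ T"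
  obtains n :: nat where "k + 1 < 2 ^ n" "2 ^ n \<le> l" "2 ^ n \<le> k + T" "l < 2 ^ n + T"
proof -
  let ?q = "quotient_seq dyadic_step"
  have pos: "0 < ?q i" for i by (simp add: quotient_dyadic_step)
  define n where "n = floor_log l"
  have nl: "2 ^ n \<le> l" using \<open>k < l\<close> by (simp add: n_def floor_log_exp2_le)
  have kn: "k + 1 < 2 ^ n"
  proof (rule ccontr)
    assume "\<not> k + 1 < 2 ^ n"
    then have "2 ^ n \<le> k + 1" by simp
    then have *: "floor_log i = n" if "i \<in> {k+1..l}" for i
      using that floor_log_le_iff[of "2 ^ n" i] floor_log_le_iff[of i l] by (simp add: n_def)
    have "lusky_B dyadic_step k l = (\<Prod>i=k+1..l. 4 ^ n) / (4 ^ n) ^ (l - k)"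
      unfolding lusky_B_def quotient_dyadic_step using * \<open>k < l\<close> by simp
    then show False using B by simp
  qed
  have below: "floor_log i < n" if "i < 2 ^ n" for i
  proof (cases "i = 0")
    case True
    then show ?thesis using kn by (cases n) auto
  next
    case False
    then have "(2 :: nat) ^ floor_log i < 2 ^ n"
      using floor_log_exp2_le[of i] that by linarith
    then show ?thesis by simp
  qed
  have jump: "4 * ?q i \<le> ?q j" if "i < 2 ^ n" "2 ^ n \<le> j" for i j
  proof -
    have "Suc (floor_log i) \<le> floor_log j"
      using below[OF that(1)] floor_log_le_iff[OF that(2)] by simp
    then have "(4 :: real) ^ Suc (floor_log i) \<le> 4 ^ floor_log j"
      by (intro power_increasing) auto
    then show ?thesis by (simp add: quotient_dyadic_step)
  qed
  have "4 ^ (l + 1 - 2 ^ n) \<le> lusky_B dyadic_step k l"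
    using kn jump by (intro lusky_B_ge_power pos quotient_dyadic_step_mono) auto
  then have "(4 :: real) ^ (l + 1 - 2 ^ n) < 4 ^ T" using K by linarith
  then have "l + 1 - 2 ^ n < T" by simp
  moreover have "4 ^ (2 ^ n - (k + 1)) \<le> lusky_A dyadic_step k l"
    using nl jump by (intro lusky_A_ge_power pos quotient_dyadic_step_mono) auto
  then have "(4 :: real) ^ (2 ^ n - (k + 1)) < 4 ^ T" using K by linarith
  then have "2 ^ n - (k + 1) < T" by simp
  ultimately show ?thesis using kn nl by (intro that[of n]) auto
qed

lemma no_lusky_numbers_dyadic_step: "\<not> lusky_numbers dyadic_step a"
proof
  assume "lusky_numbers dyadic_step a"
  then obtain b K :: real where mono: "strict_mono_on {1..} a" and b: "2 < b"
    and bd: "\<And>j. 1 \<le> j \<Longrightarrow>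
      b \<le> min (lusky_A dyadic_step (a j) (a (j + 1))) (lusky_B dyadic_step (a j) (a (j + 1))) \<and>
      max (lusky_A dyadic_step (a j) (a (j + 1))) (lusky_B dyadic_step (a j) (a (j + 1))) \<le> K"
    unfolding lusky_numbers_def by blast
  obtain T :: nat where T: "K < 4 ^ T" using real_arch_pow[of 4 K] by auto
  have step: "a j < a (j + 1)" if "1 \<le> j" for j
    using mono that by (auto simp: strict_mono_on_def)
  have block: "\<exists>n. a j + 1 < 2 ^ n \<and> 2 ^ n \<le> a (j + 1) \<and> 2 ^ n \<le> a j + T \<and> a (j + 1) < 2 ^ n + T"
    if "1 \<le> j" for j
    using lusky_block_near_jump[OF step[OF that], of K T] bd[OF that] b T by fastforce
  have large: "j \<le> a (j + 1)" for j
  proof (induction j)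
    case (Suc j)
    then show ?case using step[of "j + 1"] by simp
  qed simp
  \<comment> \<open>Beyond index \<open>2 T\<close> consecutive jumps differ by more than \<open>2 T\<close>.\<close>
  define j where "j = 2 * T + 1"
  obtain n where n: "a j + 1 < 2 ^ n" "2 ^ n \<le> a (j + 1)" "a (j + 1) < 2 ^ n + T"
    using block[of j] by (auto simp: j_def)
  obtain m where m: "a (j + 1) + 1 < 2 ^ m" "2 ^ m \<le> a (j + 1) + T"
    using block[of "j + 1"] by (auto simp: j_def)
  have "(2 :: nat) ^ n < 2 ^ m" using n m by linarith
  then have "Suc n \<le> m" by simp
  then have "(2 :: nat) ^ Suc n \<le> 2 ^ m" by (intro power_increasing) auto
  then have "2 ^ n < 2 * T" using n m by simp
  moreover have "2 * T < 2 ^ n" using n large[of "2 * T"] by (simp add: j_def)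
  ultimately show False by simp
qed

theorem lemma5p8:
  "\<exists>M\<in>LC. mod_growth M \<and> beta1 M \<and> (\<exists>N\<in>SR. equivalent_seq M N) \<and>
     \<not> (\<exists>a :: nat \<Rightarrow> nat. (\<forall>j\<ge>1. 0 < a j) \<and> lusky_numbers M a)"
  using dyadic_step_in_LC mod_growth_dyadic_step beta1_dyadic_step fact_sq_in_SR
    dyadic_step_equivalent_fact_sq no_lusky_numbers_dyadic_step
  by blast

end
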